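(* (Fully continuous limit of A2: the modified Boussinesq equation.) Let $g_3(s)=s^3+\alpha_2s^2+\alpha_1s+\alpha_0$ with real coefficients and $a\in\mathbb R$. For $p\neq a$ and nowhere-zero smooth functions $v_{-1},v_0,v_1$ of a real variable (with $'$ the derivative), let $$S_p[v]=\frac{v_1''}{v_1}+\frac{v_0''}{v_0}+\frac{v_{-1}''}{v_{-1}}-2\left(\frac{v_1'}{v_1}\right)^2-\left(\frac{v_0'}{v_0}\right)^2-\frac{v_1'v_0'}{v_1v_0}+\frac{v_{-1}'v_0'}{v_{-1}v_0}+3(p-a)\left(\frac{v_{-1}'}{v_0}-\frac{v_1'v_0}{v_1^2}\right)+(\alpha_2+3a)\left(\frac{v_{-1}'}{v_{-1}}-\frac{v_1'}{v_1}\right)$$ $$-\left(\frac{v_1}{v_0}-\frac{v_0}{v_{-1}}\right)\frac{g_3(p)-g_3(a)}{a-p}-\left(\frac{v_{-1}}{v_0}-\frac{v_0}{v_1}\right)(\alpha_2+3a)(a-p)+\left(\frac{v_{-1}^2}{v_0^2}-\frac{v_0^2}{v_1^2}\right)(a-p)^2 .$$ Let $V=V(x,t)$ be a smooth real function on $\mathbb R^2$. For small $\delta>0$ put $p=1/\delta$ and, for $\nu\in\{-1,0,1\}$, $$v_\nu(x)=\exp V\big(x+\nu\delta(1-\tfrac13\alpha_2\delta),\;t+\tfrac12\nu\delta^2\big)\qquad(\,'=\partial_x).$$ Then, pointwise in $(x,t)$, as $\delta\to0^+$, $$4\delta^{-2}S_{1/\delta}[v]\longrightarrow V_{xxxx}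-6V_{xx}V_x^2+6V_{xx}V_t-4(\alpha_2+3a)V_{xx}V_x+4\big(\alpha_1-\tfrac13\alpha_2^2\big)V_{xx}+3V_{tt}.$$
   Context: $S_p[v]=0$ is the semi-discrete (straight-limit) form of the one-component A2 lattice equation; the vanishing of the limit is the modified Boussinesq equation. The substitution corresponds to $v_\nu=v(y+\nu\delta,x)$, $v=e^V$, with the change of variables $\partial_y=(1-\tfrac13\alpha_2\delta)\partial_x+\tfrac12\delta\,\partial_t$. *)

theory Defs
  imports "HOL-Analysis.Analysis"
begin

text \<open>Smoothness in the Frechet sense: a function is \<open>C\<^sup>n\<^sup>+\<^sup>1\<close> iff it is differentiable
  everywhere and all its directional derivatives are \<open>C\<^sup>n\<close>.\<close>

primrec Ck :: "nat \<Rightarrow> ('a::euclidean_space \<Rightarrow> 'b::real_normed_vector) \<Rightarrow> bool" where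
  "Ck 0 f \<longleftrightarrow> continuous_on UNIV f"
| "Ck (Suc n) f \<longleftrightarrow> (\<forall>z. f differentiable (at z)) \<and>
     (\<forall>w. Ck n (\<lambda>z. frechet_derivative f (at z) w))"

definition smooth :: "('a::euclidean_space \<Rightarrow> 'b::real_normed_vector) \<Rightarrow> bool" where
  "smooth f \<longleftrightarrow> (\<forall>n. Ck n f)"

definition Dx :: "(real \<times> real \<Rightarrow> real) \<Rightarrow> real \<times> real \<Rightarrow> real" where
  "Dx f = (\<lambda>(x, t). deriv (\<lambda>s. f (s, t)) x)"

definition Dt :: "(real \<times> real \<Rightarrow> real) \<Rightarrow> real \<times> real \<Rightarrow> real" where
  "Dt f = (\<lambda>(x, t). deriv (\<lambda>s. f (x, s)) t)"

definition g3 :: "real \<Rightarrow> real \<Rightarrow> real \<Rightarrow> real \<Rightarrow> real" where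
  "g3 \<alpha>\<^sub>0 \<alpha>\<^sub>1 \<alpha>\<^sub>2 s = s ^ 3 + \<alpha>\<^sub>2 * s ^ 2 + \<alpha>\<^sub>1 * s + \<alpha>\<^sub>0"

text \<open>The expression \<open>S\<^sub>p[v]\<close> at the point \<open>x\<close>, for a family \<open>v \<nu>\<close> of which only the members
  \<open>\<nu> = -1, 0, 1\<close> occur.  It is meaningful for \<open>p \<noteq> a\<close> and nowhere-zero smooth \<open>v \<nu>\<close>; outside
  this domain it takes values determined by the totality of \<open>/\<close> and \<open>deriv\<close>.\<close>

definition S :: "real \<Rightarrow> real \<Rightarrow> real \<Rightarrow> real \<Rightarrow> real \<Rightarrow> (int \<Rightarrow> real \<Rightarrow> real) \<Rightarrow> real \<Rightarrow> real" where
  "S \<alpha>\<^sub>0 \<alpha>\<^sub>1 \<alpha>\<^sub>2 a p v x =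
    (let v1 = v 1 x; v0 = v 0 x; vm = v (-1) x;
         v1' = deriv (v 1) x; v0' = deriv (v 0) x; vm' = deriv (v (-1)) x;
         v1'' = deriv (deriv (v 1)) x; v0'' = deriv (deriv (v 0)) x;
         vm'' = deriv (deriv (v (-1))) x
     in v1'' / v1 + v0'' / v0 + vm'' / vm
        - 2 * (v1' / v1) ^ 2 - (v0' / v0) ^ 2
        - (v1' * v0') / (v1 * v0) + (vm' * v0') / (vm * v0)
        + 3 * (p - a) * (vm' / v0 - (v1' * v0) / v1 ^ 2)
        + (\<alpha>\<^sub>2 + 3 * a) * (vm' / vm - v1' / v1)
        - (v1 / v0 - v0 / vm) * ((g3 \<alpha>\<^sub>0 \<alpha>\<^sub>1 \<alpha>\<^sub>2 p - g3 \<alpha>\<^sub>0 \<alpha>\<^sub>1 \<alpha>\<^sub>2 a) / (a - p))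
        - (vm / v0 - v0 / v1) * (\<alpha>\<^sub>2 + 3 * a) * (a - p)
        + (vm ^ 2 / v0 ^ 2 - v0 ^ 2 / v1 ^ 2) * (a - p) ^ 2)"

definition v_shift :: "real \<Rightarrow> (real \<times> real \<Rightarrow> real) \<Rightarrow> real \<Rightarrow> real \<Rightarrow> int \<Rightarrow> real \<Rightarrow> real" where
  "v_shift \<alpha>\<^sub>2 V \<delta> t \<nu> = (\<lambda>x. exp (V (x + of_int \<nu> * \<delta> * (1 - 1/3 * \<alpha>\<^sub>2 * \<delta>),
                                     t + 1/2 * of_int \<nu> * \<delta> ^ 2)))"

end

theory Submission
  imports Defs "HOL-Real_Asymp.Real_Asymp"
begin

text \<open>Write \<open>v\<^sub>\<nu> = exp W\<^sub>\<nu>\<close> and split the lattice differences into an odd part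
  \<open>u = (W\<^sub>1 - W\<^sub>-\<^sub>1) / 2 = O(\<delta>)\<close> and an even part \<open>w = (W\<^sub>1 + W\<^sub>-\<^sub>1) / 2 - W\<^sub>0 = O(\<delta>\<^sup>2)\<close>.
  In these variables every difference of quotients of the \<open>v\<^sub>\<nu>\<close> is a multiple of \<open>exp (k u)\<close>
  by \<open>sinh w\<close>, \<open>cosh w\<close> or \<open>sinh (2 w)\<close>, which absorbs the powers of \<open>p = 1/\<delta>\<close>: all that is
  needed are second-order expansions of \<open>u/\<delta>\<close>, \<open>w/\<delta>\<^sup>2\<close> and their \<open>x\<close>-derivatives.
  The coefficients of \<open>\<delta>\<^sup>0\<close> and \<open>\<delta>\<^sup>1\<close> in \<open>S\<close> then cancel.\<close>

section \<open>Partial derivatives of smooth functions\<close>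

lemma smooth_has_derivative:
  "smooth f \<Longrightarrow> (f has_derivative frechet_derivative f (at z)) (at z)"
  unfolding smooth_def by (metis Ck.simps(2) frechet_derivative_works)

lemma smooth_directional_derivative:
  assumes "smooth f"
  shows "smooth (\<lambda>z. frechet_derivative f (at z) w)"
  unfolding smooth_def
proof
  fix n
  have "Ck (Suc n) f"
    using assms unfolding smooth_def by blast
  then show "Ck n (\<lambda>z. frechet_derivative f (at z) w)" by simp
qed

lemma smooth_isCont:
  assumes "smooth f"
  shows "isCont f z"
  using smooth_has_derivative[OF assms] has_derivative_continuous by blast

text \<open>Chain rule along the line \<open>s \<mapsto> (s, t)\<close>. Linearity of the Frechet
  derivative then turns \<open>h \<mapsto> ?D (h, 0)\<close> into multiplication by a number, as
  \<open>has_real_derivative\<close> requires.\<close>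

lemma smooth_DERIV_x_frechet:
  fixes f :: "real \<times> real \<Rightarrow> real"
  assumes "smooth f"
  shows "((\<lambda>s. f (s, t)) has_real_derivative frechet_derivative f (at (x, t)) (1, 0)) (at x)"
proof -
  let ?D = "frechet_derivative f (at (x, t))"
  have 1: "((\<lambda>s. (s, t)) has_derivative (\<lambda>h. (h, 0))) (at x)"
    by (auto intro!: derivative_eq_intros)
  have 2: "((\<lambda>s. f (s, t)) has_derivative (\<lambda>h. ?D (h, 0))) (at x)"
    using diff_chain_at[OF 1, of f ?D] smooth_has_derivative[OF assms, of "(x, t)"]
    by (simp add: o_def)
  have "linear ?D"
    using smooth_has_derivative[OF assms] has_derivative_linear by blast
  then have scale: "?D (h *\<^sub>R (1, 0)) = h *\<^sub>R ?D (1, 0)" for h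
    by (rule linear_scale)
  have "(\<lambda>h. ?D (h, 0)) = (*) (?D (1, 0))"
  proof
    fix h show "?D (h, 0) = ?D (1, 0) * h"
      using scale[of h] by (simp add: mult.commute)
  qed
  with 2 show ?thesis unfolding has_field_derivative_def by (simp only:)
qed

lemma smooth_DERIV_t_frechet:
  fixes f :: "real \<times> real \<Rightarrow> real"
  assumes "smooth f"
  shows "((\<lambda>s. f (x, s)) has_real_derivative frechet_derivative f (at (x, t)) (0, 1)) (at t)"
proof -
  let ?D = "frechet_derivative f (at (x, t))"
  have 1: "((\<lambda>s. (x, s)) has_derivative (\<lambda>h. (0, h))) (at t)"
    by (auto intro!: derivative_eq_intros)
  have 2: "((\<lambda>s. f (x, s)) has_derivative (\<lambda>h. ?D (0, h))) (at t)"
    using diff_chain_at[OF 1, of f ?D] smooth_has_derivative[OF assms, of "(x, t)"]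
    by (simp add: o_def)
  have "linear ?D"
    using smooth_has_derivative[OF assms] has_derivative_linear by blast
  then have scale: "?D (h *\<^sub>R (0, 1)) = h *\<^sub>R ?D (0, 1)" for h
    by (rule linear_scale)
  have "(\<lambda>h. ?D (0, h)) = (*) (?D (0, 1))"
  proof
    fix h show "?D (0, h) = ?D (0, 1) * h"
      using scale[of h] by (simp add: mult.commute)
  qed
  with 2 show ?thesis unfolding has_field_derivative_def by (simp only:)
qed

text \<open>Bridge between \<open>deriv\<close>, which defines \<open>Dx\<close>, and the Frechet
  derivatives that define \<open>smooth\<close>; through it smoothness passes to iterated partial
  derivatives.\<close>

lemma Dx_eq_frechet: "smooth f \<Longrightarrow> Dx f = (\<lambda>z. frechet_derivative f (at z) (1, 0))"
  using DERIV_imp_deriv[OF smooth_DERIV_x_frechet] by (auto simp: Dx_def)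

lemma Dt_eq_frechet: "smooth f \<Longrightarrow> Dt f = (\<lambda>z. frechet_derivative f (at z) (0, 1))"
  using DERIV_imp_deriv[OF smooth_DERIV_t_frechet] by (auto simp: Dt_def)

lemma smooth_Dx: "smooth f \<Longrightarrow> smooth (Dx f)"
  by (simp add: Dx_eq_frechet smooth_directional_derivative)

lemma smooth_Dt: "smooth f \<Longrightarrow> smooth (Dt f)"
  by (simp add: Dt_eq_frechet smooth_directional_derivative)

lemma smooth_Dx_funpow: "smooth f \<Longrightarrow> smooth ((Dx ^^ n) f)"
  by (induction n) (auto intro: smooth_Dx)

lemma smooth_Dt_funpow: "smooth f \<Longrightarrow> smooth ((Dt ^^ n) f)"
  by (induction n) (auto intro: smooth_Dt)

lemma DERIV_Dx: "smooth f \<Longrightarrow> ((\<lambda>s. f (s, t)) has_real_derivative Dx f (x, t)) (at x)"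
  using smooth_DERIV_x_frechet Dx_eq_frechet by metis

lemma DERIV_Dt: "smooth f \<Longrightarrow> ((\<lambda>s. f (x, s)) has_real_derivative Dt f (x, t)) (at t)"
  using smooth_DERIV_t_frechet Dt_eq_frechet by metis

lemma DERIV_Dx_shift:
  assumes "smooth f"
  shows "((\<lambda>s. f (s + c, t)) has_real_derivative Dx f (x + c, t)) (at x)"
  by (rule DERIV_shift[THEN iffD1, OF DERIV_Dx[OF assms]])

section \<open>Taylor expansion along weighted displacements\<close>

text \<open>Lagrange's remainder sits at an unknown point within \<open>\<bar>h d\<bar>\<close> of
  \<open>s0\<close>; joint continuity of \<open>g n\<close> replaces its value by the one at the
  base point plus an error tending to 0. The parameter \<open>y\<close> moves along with
  \<open>d\<close>, so that an expansion in one variable can be made at a displaced value of the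
  other.\<close>

lemma taylor_remainder_limit:
  fixes g :: "nat \<Rightarrow> real \<Rightarrow> real \<Rightarrow> real" and h k :: "'a \<Rightarrow> real"
  assumes der: "\<And>m y s. m < n \<Longrightarrow> (g m y has_real_derivative g (Suc m) y s) (at s)"
    and cont: "isCont (\<lambda>(y, s). g n y s) (y0, s0)"
    and h: "(h \<longlongrightarrow> 0) F" and k: "(k \<longlongrightarrow> 0) F"
  shows "\<exists>e. (e \<longlongrightarrow> 0) F \<and> (\<forall>d. g 0 (y0 + k d) (s0 + h d) =
           (\<Sum>m<n. g m (y0 + k d) s0 / fact m * h d ^ m)
           + (g n y0 s0 + e d) / fact n * h d ^ n)"
proof -
  have "\<exists>\<theta>. \<bar>\<theta>\<bar> \<le> \<bar>h d\<bar> \<and> g 0 (y0 + k d) (s0 + h d) =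
           (\<Sum>m<n. g m (y0 + k d) s0 / fact m * h d ^ m)
           + g n (y0 + k d) (s0 + \<theta>) / fact n * h d ^ n" for d
  proof -
    have "\<exists>t. \<bar>t\<bar> \<le> \<bar>h d\<bar> \<and> g 0 (y0 + k d) (s0 + h d) =
       (\<Sum>m<n. (\<lambda>s. g m (y0 + k d) (s0 + s)) 0 / fact m * h d ^ m)
         + (\<lambda>s. g n (y0 + k d) (s0 + s)) t / fact n * h d ^ n"
    proof (rule Maclaurin_bi_le[where diff = "\<lambda>m s. g m (y0 + k d) (s0 + s)"])
      show "\<forall>m s. m < n \<and> \<bar>s\<bar> \<le> \<bar>h d\<bar> \<longrightarrow>
          ((\<lambda>s. g m (y0 + k d) (s0 + s)) has_real_derivative g (Suc m) (y0 + k d) (s0 + s)) (at s)"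
        using DERIV_shift[THEN iffD1, OF der] by (simp add: add.commute[of s0])
    qed simp
    then show ?thesis by simp
  qed
  \<comment> \<open>The intermediate point is chosen as a function of \<open>d\<close>, so that its
    limit along \<open>F\<close> makes sense.\<close>
  then have "\<exists>\<theta>. \<forall>d. \<bar>\<theta> d\<bar> \<le> \<bar>h d\<bar> \<and> g 0 (y0 + k d) (s0 + h d) =
           (\<Sum>m<n. g m (y0 + k d) s0 / fact m * h d ^ m)
           + g n (y0 + k d) (s0 + \<theta> d) / fact n * h d ^ n"
    by (intro choice allI)
  then obtain \<theta> where \<theta>: "\<And>d. \<bar>\<theta> d\<bar> \<le> \<bar>h d\<bar>"
    and eq: "\<And>d. g 0 (y0 + k d) (s0 + h d) =
           (\<Sum>m<n. g m (y0 + k d) s0 / fact m * h d ^ m)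
           + g n (y0 + k d) (s0 + \<theta> d) / fact n * h d ^ n"
    by blast
  have \<theta>0: "(\<theta> \<longlongrightarrow> 0) F"
    by (rule Lim_null_comparison[OF _ tendsto_rabs_zero[OF h]]) (auto simp: \<theta>)
  have "((\<lambda>d. (y0 + k d, s0 + \<theta> d)) \<longlongrightarrow> (y0 + 0, s0 + 0)) F"
    by (intro tendsto_intros k \<theta>0)
  then have "((\<lambda>d. (\<lambda>(y, s). g n y s) (y0 + k d, s0 + \<theta> d)) \<longlongrightarrow> (\<lambda>(y, s). g n y s) (y0, s0)) F"
    by (intro isCont_tendsto_compose[OF cont]) simp
  then have "((\<lambda>d. g n (y0 + k d) (s0 + \<theta> d) - g n y0 s0) \<longlongrightarrow> 0) F"
    using LIM_zero by fastforce
  then show ?thesis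
    using eq by (intro exI[of _ "\<lambda>d. g n (y0 + k d) (s0 + \<theta> d) - g n y0 s0"]) auto
qed

text \<open>The lower coefficients stay at the displaced time \<open>t + k d\<close>, to be expanded
  in a second pass; only the top one is moved to \<open>(x, t)\<close>.\<close>

lemma taylor_x:
  assumes "smooth f" and "(h \<longlongrightarrow> 0) F" "(k \<longlongrightarrow> 0) F"
  shows "\<exists>e. (e \<longlongrightarrow> 0) F \<and> (\<forall>d. f (x + h d, t + k d) =
           (\<Sum>m<n. (Dx ^^ m) f (x, t + k d) / fact m * h d ^ m)
           + ((Dx ^^ n) f (x, t) + e d) / fact n * h d ^ n)"
proof -
  have "isCont (\<lambda>z. (Dx ^^ n) f (snd z, fst z)) (t, x)"
    by (rule isCont_o2[OF _ smooth_isCont[OF smooth_Dx_funpow[OF assms(1)]]])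
      (intro continuous_intros)
  then have c: "isCont (\<lambda>(y, s). (Dx ^^ n) f (s, y)) (t, x)"
    by (simp add: case_prod_unfold)
  show ?thesis
    using taylor_remainder_limit[of n "\<lambda>m y s. (Dx ^^ m) f (s, y)", OF _ c assms(2,3)]
      DERIV_Dx[OF smooth_Dx_funpow[OF assms(1)]] by simp
qed

lemma taylor_t:
  assumes "smooth f" and "(k \<longlongrightarrow> 0) F"
  shows "\<exists>e. (e \<longlongrightarrow> 0) F \<and> (\<forall>d. f (x, t + k d) =
           (\<Sum>m<n. (Dt ^^ m) f (x, t) / fact m * k d ^ m)
           + ((Dt ^^ n) f (x, t) + e d) / fact n * k d ^ n)"
proof -
  have c: "isCont (\<lambda>(y, s). (Dt ^^ n) f (y, s)) (x, t)"
    using smooth_isCont[OF smooth_Dt_funpow[OF assms(1)]] by simp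
  \<comment> \<open>The parameter \<open>x\<close> is frozen here, hence the constant displacement
    0.\<close>
  show ?thesis
    using taylor_remainder_limit[of n "\<lambda>m y s. (Dt ^^ m) f (y, s)",
        OF _ c assms(2) tendsto_const[of 0]]
      DERIV_Dt[OF smooth_Dt_funpow[OF assms(1)]] by simp
qed

text \<open>Exactly the Taylor monomials of weight at most 4, when \<open>h\<close> counts 1 and
  \<open>k\<close> counts 2.\<close>

definition taylor4 :: "(real \<times> real \<Rightarrow> real) \<Rightarrow> real \<Rightarrow> real \<Rightarrow> real \<Rightarrow> real \<Rightarrow> real" where
  "taylor4 f x t h k =
     f (x, t) + h * Dx f (x, t) + h\<^sup>2 / 2 * (Dx ^^ 2) f (x, t) + h ^ 3 / 6 * (Dx ^^ 3) f (x, t)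
     + h ^ 4 / 24 * (Dx ^^ 4) f (x, t) + k * Dt f (x, t) + h * k * Dt (Dx f) (x, t)
     + h\<^sup>2 * k / 2 * Dt ((Dx ^^ 2) f) (x, t) + k\<^sup>2 / 2 * (Dt ^^ 2) f (x, t)"

text \<open>Here \<open>x\<close> has weight 1 and \<open>t\<close> has weight 2.  Expanding in \<open>x\<close> first makes every mixed
  derivative appear in the order \<open>Dt (Dx \<dots>)\<close>, so that symmetry of second derivatives is never
  needed.\<close>

lemma weighted_taylor:
  fixes f :: "real \<times> real \<Rightarrow> real"
  assumes f: "smooth f"
    and h: "(h \<longlongrightarrow> H) (at_right 0)" and k: "(k \<longlongrightarrow> K) (at_right 0)"
  shows "\<exists>e. (e \<longlongrightarrow> 0) (at_right 0) \<and> (\<forall>d. f (x + d * h d, t + d\<^sup>2 * k d) =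
     taylor4 f x t (d * h d) (d\<^sup>2 * k d) + d ^ 4 * e d)"
proof -
  have d0: "((\<lambda>d::real. d) \<longlongrightarrow> 0) (at_right 0)" by (rule tendsto_ident_at)
  have h0: "((\<lambda>d. d * h d) \<longlongrightarrow> 0) (at_right 0)"
    using tendsto_mult[OF d0 h] by simp
  have k0: "((\<lambda>d. d\<^sup>2 * k d) \<longlongrightarrow> 0) (at_right 0)"
    using tendsto_mult[OF tendsto_power[OF d0, of 2] k] by simp
  note sm = smooth_Dx_funpow[OF f]
  obtain e4 where e4: "(e4 \<longlongrightarrow> 0) (at_right 0)"
    "\<And>d. f (x + d * h d, t + d\<^sup>2 * k d) =
           (\<Sum>m<4. (Dx ^^ m) f (x, t + d\<^sup>2 * k d) / fact m * (d * h d) ^ m)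
           + ((Dx ^^ 4) f (x, t) + e4 d) / fact 4 * (d * h d) ^ 4"
    using taylor_x[OF f h0 k0] by blast
  \<comment> \<open>The coefficient of \<open>h ^ m\<close> needs an expansion in \<open>t\<close>
    whose error, times \<open>h ^ m\<close>, is o(\<open>d ^ 4\<close>): order 2 for
    \<open>m = 0, 1\<close> and order 1 for \<open>m = 2, 3\<close>.\<close>
  obtain e0 where e0: "(e0 \<longlongrightarrow> 0) (at_right 0)"
    "\<And>d. f (x, t + d\<^sup>2 * k d) = (\<Sum>m<2. (Dt ^^ m) f (x, t) / fact m * (d\<^sup>2 * k d) ^ m)
           + ((Dt ^^ 2) f (x, t) + e0 d) / fact 2 * (d\<^sup>2 * k d) ^ 2"
    using taylor_t[OF f k0] by blast
  obtain e1 where e1: "(e1 \<longlongrightarrow> 0) (at_right 0)"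
    "\<And>d. Dx f (x, t + d\<^sup>2 * k d) = (\<Sum>m<2. (Dt ^^ m) (Dx f) (x, t) / fact m * (d\<^sup>2 * k d) ^ m)
           + ((Dt ^^ 2) (Dx f) (x, t) + e1 d) / fact 2 * (d\<^sup>2 * k d) ^ 2"
    using taylor_t[OF smooth_Dx[OF f] k0] by blast
  obtain e2 where e2: "(e2 \<longlongrightarrow> 0) (at_right 0)"
    "\<And>d. (Dx ^^ 2) f (x, t + d\<^sup>2 * k d) =
        (\<Sum>m<1. (Dt ^^ m) ((Dx ^^ 2) f) (x, t) / fact m * (d\<^sup>2 * k d) ^ m)
           + ((Dt ^^ 1) ((Dx ^^ 2) f) (x, t) + e2 d) / fact 1 * (d\<^sup>2 * k d) ^ 1"
    using taylor_t[OF sm k0] by blast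
  obtain e3 where e3: "(e3 \<longlongrightarrow> 0) (at_right 0)"
    "\<And>d. (Dx ^^ 3) f (x, t + d\<^sup>2 * k d) =
        (\<Sum>m<1. (Dt ^^ m) ((Dx ^^ 3) f) (x, t) / fact m * (d\<^sup>2 * k d) ^ m)
           + ((Dt ^^ 1) ((Dx ^^ 3) f) (x, t) + e3 d) / fact 1 * (d\<^sup>2 * k d) ^ 1"
    using taylor_t[OF sm k0] by blast
  \<comment> \<open>The errors \<open>e4\<close>, \<open>e0\<close>, \<open>e2\<close> come with
    weight exactly 4. The other two terms have weight 5, and their surplus factor \<open>d\<close>
    makes them vanish.\<close>
  define e where "e d = (h d) ^ 4 / 24 * e4 d + (k d)\<^sup>2 / 2 * e0 d
      + d * h d * (k d)\<^sup>2 / 2 * ((Dt ^^ 2) (Dx f) (x, t) + e1 d)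
      + (h d)\<^sup>2 / 2 * k d * e2 d
      + d * (h d) ^ 3 / 6 * k d * (Dt ((Dx ^^ 3) f) (x, t) + e3 d)" for d
  have "(e \<longlongrightarrow> H ^ 4 / 24 * 0 + K\<^sup>2 / 2 * 0
      + 0 * H * K\<^sup>2 / 2 * ((Dt ^^ 2) (Dx f) (x, t) + 0)
      + H\<^sup>2 / 2 * K * 0 + 0 * H ^ 3 / 6 * K * (Dt ((Dx ^^ 3) f) (x, t) + 0)) (at_right 0)"
    unfolding e_def by (intro tendsto_intros h k e4(1) e0(1) e1(1) e2(1) e3(1)) auto
  then have "(e \<longlongrightarrow> 0) (at_right 0)" by simp
  moreover have "f (x + d * h d, t + d\<^sup>2 * k d) =
     taylor4 f x t (d * h d) (d\<^sup>2 * k d) + d ^ 4 * e d" for d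
  proof -
    have l: "{..<4::nat} = {0,1,2,3}" "{..<2::nat} = {0,1}" by auto
    have fct: "fact 4 = (24::real)" "fact 3 = (6::real)" by (simp_all add: fact_numeral)
    have 4: "f (x + d * h d, t + d\<^sup>2 * k d) = f (x, t + d\<^sup>2 * k d)
      + Dx f (x, t + d\<^sup>2 * k d) * (d * h d) + (Dx ^^ 2) f (x, t + d\<^sup>2 * k d) / 2 * (d * h d)\<^sup>2
      + (Dx ^^ 3) f (x, t + d\<^sup>2 * k d) / 6 * (d * h d) ^ 3
      + ((Dx ^^ 4) f (x, t) + e4 d) / 24 * (d * h d) ^ 4"
      unfolding e4(2)[of d] l by (simp add: fct)
    have 0: "f (x, t + d\<^sup>2 * k d) = f (x, t) + Dt f (x, t) * (d\<^sup>2 * k d)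
       + ((Dt ^^ 2) f (x, t) + e0 d) / 2 * (d\<^sup>2 * k d)\<^sup>2"
      unfolding e0(2)[of d] l by simp
    have 1: "Dx f (x, t + d\<^sup>2 * k d) = Dx f (x, t) + Dt (Dx f) (x, t) * (d\<^sup>2 * k d)
       + ((Dt ^^ 2) (Dx f) (x, t) + e1 d) / 2 * (d\<^sup>2 * k d)\<^sup>2"
      unfolding e1(2)[of d] l by simp
    have 2: "(Dx ^^ 2) f (x, t + d\<^sup>2 * k d) = (Dx ^^ 2) f (x, t)
       + (Dt ((Dx ^^ 2) f) (x, t) + e2 d) * (d\<^sup>2 * k d)"
      unfolding e2(2)[of d] by simp
    have 3: "(Dx ^^ 3) f (x, t + d\<^sup>2 * k d) = (Dx ^^ 3) f (x, t)
       + (Dt ((Dx ^^ 3) f) (x, t) + e3 d) * (d\<^sup>2 * k d)"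
      unfolding e3(2)[of d] by simp
    show ?thesis
      unfolding 4 0 1 2 3 e_def taylor4_def
      by (simp add: field_simps power2_eq_square power3_eq_cube power4_eq_xxxx)
  qed
  ultimately show ?thesis by blast
qed

section \<open>Second-order expansions at the origin\<close>

text \<open>An expansion with remainder o(\<open>d^2\<close>), as an exact identity for every
  \<open>d > 0\<close>. The point \<open>d = 0\<close> is left out because the functions expanded
  contain quotients by powers of \<open>d\<close>.\<close>

definition jet2 :: "(real \<Rightarrow> real) \<Rightarrow> real \<Rightarrow> real \<Rightarrow> real \<Rightarrow> bool" where
  "jet2 f c0 c1 c2 \<longleftrightarrow> (\<exists>e. (e \<longlongrightarrow> 0) (at_right 0) \<and>
     (\<forall>d>0. f d = c0 + c1 * d + c2 * d\<^sup>2 + d\<^sup>2 * e d))"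

lemma jet2I:
  assumes "(e \<longlongrightarrow> 0) (at_right 0)" "\<And>d. d > 0 \<Longrightarrow> f d = c0 + c1 * d + c2 * d\<^sup>2 + d\<^sup>2 * e d"
  shows "jet2 f c0 c1 c2"
  using assms unfolding jet2_def by blast

lemma jet2E:
  assumes "jet2 f c0 c1 c2"
  obtains e where "(e \<longlongrightarrow> 0) (at_right 0)"
    "\<And>d. d > 0 \<Longrightarrow> f d = c0 + c1 * d + c2 * d\<^sup>2 + d\<^sup>2 * e d"
  using assms unfolding jet2_def by blast

text \<open>Separates matching the function from checking the three coefficients; the cancellation
  of the low orders of \<open>S\<close> is verified through it.\<close>

lemma jet2_cong:
  assumes "jet2 f c0 c1 c2" "\<And>d. d > 0 \<Longrightarrow> g d = f d" "b0 = c0" "b1 = c1" "b2 = c2"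
  shows "jet2 g b0 b1 b2"
  using assms unfolding jet2_def by auto

lemma jet2_const: "jet2 (\<lambda>d. c) c 0 0"
  by (rule jet2I[of "\<lambda>d. 0"]) auto

lemma jet2_ident: "jet2 (\<lambda>d. d) 0 1 0"
  by (rule jet2I[of "\<lambda>d. 0"]) auto

lemma jet2_add:
  assumes "jet2 f a0 a1 a2" "jet2 g b0 b1 b2"
  shows "jet2 (\<lambda>d. f d + g d) (a0 + b0) (a1 + b1) (a2 + b2)"
proof -
  obtain r where r: "(r \<longlongrightarrow> 0) (at_right 0)"
    "\<And>d. d > 0 \<Longrightarrow> f d = a0 + a1 * d + a2 * d\<^sup>2 + d\<^sup>2 * r d"
    using assms(1) by (rule jet2E) blast
  obtain s where s: "(s \<longlongrightarrow> 0) (at_right 0)"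
    "\<And>d. d > 0 \<Longrightarrow> g d = b0 + b1 * d + b2 * d\<^sup>2 + d\<^sup>2 * s d"
    using assms(2) by (rule jet2E) blast
  show ?thesis
    by (rule jet2I[OF tendsto_add_zero[OF r(1) s(1)]]) (simp add: r(2) s(2) algebra_simps)
qed

lemma jet2_mult:
  assumes "jet2 f a0 a1 a2" "jet2 g b0 b1 b2"
  shows "jet2 (\<lambda>d. f d * g d) (a0 * b0) (a0 * b1 + a1 * b0) (a0 * b2 + a1 * b1 + a2 * b0)"
proof -
  obtain r where r: "(r \<longlongrightarrow> 0) (at_right 0)"
    "\<And>d. d > 0 \<Longrightarrow> f d = a0 + a1 * d + a2 * d\<^sup>2 + d\<^sup>2 * r d"
    using assms(1) by (rule jet2E) blast
  obtain s where s: "(s \<longlongrightarrow> 0) (at_right 0)"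
    "\<And>d. d > 0 \<Longrightarrow> g d = b0 + b1 * d + b2 * d\<^sup>2 + d\<^sup>2 * s d"
    using assms(2) by (rule jet2E) blast
  \<comment> \<open>The cubic and quartic terms of the product of the two polynomials, divided by
    \<open>d^2\<close>, followed by everything that contains \<open>r\<close> or
    \<open>s\<close>.\<close>
  define e where "e d = d * (a1 * b2 + a2 * b1) + d\<^sup>2 * a2 * b2
     + r d * (b0 + b1 * d + b2 * d\<^sup>2 + d\<^sup>2 * s d) + (a0 + a1 * d + a2 * d\<^sup>2) * s d" for d
  have "(e \<longlongrightarrow> 0 * (a1 * b2 + a2 * b1) + 0\<^sup>2 * a2 * b2
     + 0 * (b0 + b1 * 0 + b2 * 0\<^sup>2 + 0\<^sup>2 * 0) + (a0 + a1 * 0 + a2 * 0\<^sup>2) * 0) (at_right 0)"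
    unfolding e_def by (intro tendsto_intros r(1) s(1))
  then have "(e \<longlongrightarrow> 0) (at_right 0)" by simp
  then show ?thesis
    by (rule jet2I) (simp add: r(2) s(2) e_def algebra_simps power2_eq_square)
qed

lemma jet2_cmult: "jet2 f a0 a1 a2 \<Longrightarrow> jet2 (\<lambda>d. c * f d) (c * a0) (c * a1) (c * a2)"
  using jet2_mult[OF jet2_const[of c]] by fastforce

lemma jet2_diff:
  assumes "jet2 f a0 a1 a2" "jet2 g b0 b1 b2"
  shows "jet2 (\<lambda>d. f d - g d) (a0 - b0) (a1 - b1) (a2 - b2)"
  using jet2_add[OF assms(1) jet2_cmult[OF assms(2), of "-1"]] by simp

lemma jet2_ident_mult: "jet2 f a0 a1 a2 \<Longrightarrow> jet2 (\<lambda>d. d * f d) 0 a0 a1"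
  using jet2_mult[OF jet2_ident] by fastforce

lemma jet2_tendsto:
  assumes "jet2 f c0 c1 c2"
  shows "(f \<longlongrightarrow> c0) (at_right 0)"
proof -
  obtain r where r: "(r \<longlongrightarrow> 0) (at_right 0)"
    "\<And>d. d > 0 \<Longrightarrow> f d = c0 + c1 * d + c2 * d\<^sup>2 + d\<^sup>2 * r d"
    using assms by (rule jet2E) blast
  have "((\<lambda>d. c0 + c1 * d + c2 * d\<^sup>2 + d\<^sup>2 * r d) \<longlongrightarrow> c0 + c1 * 0 + c2 * 0\<^sup>2 + 0\<^sup>2 * 0) (at_right 0)"
    by (intro tendsto_intros r(1))
  then have "((\<lambda>d. c0 + c1 * d + c2 * d\<^sup>2 + d\<^sup>2 * r d) \<longlongrightarrow> c0) (at_right 0)" by simp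
  then show ?thesis
    by (rule Lim_transform_eventually) (simp add: r(2) eventually_at_right_less eventually_at_filter)
qed

lemma jet2_quotient_tendsto:
  assumes "jet2 f 0 0 c"
  shows "((\<lambda>d. f d / d\<^sup>2) \<longlongrightarrow> c) (at_right 0)"
proof -
  obtain r where r: "(r \<longlongrightarrow> 0) (at_right 0)" "\<And>d. d > 0 \<Longrightarrow> f d = c * d\<^sup>2 + d\<^sup>2 * r d"
    using assms by (auto elim: jet2E)
  have "((\<lambda>d. c + r d) \<longlongrightarrow> c + 0) (at_right 0)"
    by (intro tendsto_intros r(1))
  then have "((\<lambda>d. c + r d) \<longlongrightarrow> c) (at_right 0)" by simp
  then show ?thesis
    by (rule Lim_transform_eventually) (simp add: r(2) eventually_at_filter field_simps)
qed

text \<open>A punctured limit of \<rho> does not compose with a \<open>g\<close> that may take the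
  value 0; \<open>\<rho> 0 = 0\<close> upgrades it to continuity.\<close>

lemma tendsto_remainder_compose:
  fixes \<rho> g :: "real \<Rightarrow> real"
  assumes "\<rho> \<midarrow>0\<rightarrow> 0" "\<rho> 0 = 0" "(g \<longlongrightarrow> 0) F"
  shows "((\<lambda>d. \<rho> (g d)) \<longlongrightarrow> 0) F"
  using isCont_tendsto_compose[of 0 \<rho> g F] assms by (simp add: isCont_def)

text \<open>The factor \<open>d\<close> raises each coefficient of \<open>f\<close> by one order, so
  \<open>c2\<close> falls into the remainder and the square contributes only
  \<open>c0^2 / 2\<close>.\<close>

lemma jet2_exp:
  assumes "jet2 f c0 c1 c2"
  shows "jet2 (\<lambda>d. exp (d * f d)) 1 c0 (c1 + c0\<^sup>2 / 2)"
proof -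
  obtain r where r: "(r \<longlongrightarrow> 0) (at_right 0)"
    "\<And>d. d > 0 \<Longrightarrow> f d = c0 + c1 * d + c2 * d\<^sup>2 + d\<^sup>2 * r d"
    using assms by (rule jet2E) blast
  \<comment> \<open>Normalised Taylor remainder; division by zero yields 0, which is the value
    wanted at the origin.\<close>
  define \<rho> where "\<rho> y = (exp y - 1 - y - y\<^sup>2 / 2) / y\<^sup>2" for y :: real
  have \<rho>: "\<rho> \<midarrow>0\<rightarrow> 0" "\<rho> 0 = 0"
    unfolding \<rho>_def by (real_asymp, simp)
  have exp_eq: "exp y = 1 + y + y\<^sup>2 / 2 + y\<^sup>2 * \<rho> y" for y
    by (cases "y = 0") (simp_all add: \<rho>_def)
  have f0: "((\<lambda>d. d * f d) \<longlongrightarrow> 0) (at_right 0)"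
    using tendsto_mult[OF tendsto_ident_at jet2_tendsto[OF assms]] by simp
  define e where "e d = d * c2 + d * r d + (f d - c0) * (f d + c0) / 2
      + (f d)\<^sup>2 * \<rho> (d * f d)" for d
  have "(e \<longlongrightarrow> 0 * c2 + 0 * 0 + (c0 - c0) * (c0 + c0) / 2 + c0\<^sup>2 * 0) (at_right 0)"
    unfolding e_def
    by (intro tendsto_intros r(1) jet2_tendsto[OF assms] tendsto_remainder_compose[OF \<rho> f0]) auto
  then have "(e \<longlongrightarrow> 0) (at_right 0)" by simp
  then show ?thesis
  proof (rule jet2I)
    fix d :: real assume d: "d > 0"
    \<comment> \<open>The expansion of \<open>f\<close> is substituted in the linear term only; in
      the quadratic terms the limit of \<open>f\<close> suffices.\<close>
    have lin: "d * f d = d * c0 + c1 * d\<^sup>2 + d\<^sup>2 * (d * c2 + d * r d)"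
      by (simp add: r(2)[OF d] algebra_simps power2_eq_square)
    have "exp (d * f d) = 1 + d * f d + (d * f d)\<^sup>2 / 2 + (d * f d)\<^sup>2 * \<rho> (d * f d)"
      by (rule exp_eq)
    also have "\<dots> = 1 + (d * c0 + c1 * d\<^sup>2 + d\<^sup>2 * (d * c2 + d * r d))
        + (d * f d)\<^sup>2 / 2 + (d * f d)\<^sup>2 * \<rho> (d * f d)"
      by (simp only: lin[symmetric])
    also have "\<dots> = 1 + c0 * d + (c1 + c0\<^sup>2 / 2) * d\<^sup>2 + d\<^sup>2 * e d"
      unfolding e_def by (simp add: field_simps power2_eq_square)
    finally show "exp (d * f d) = 1 + c0 * d + (c1 + c0\<^sup>2 / 2) * d\<^sup>2 + d\<^sup>2 * e d" .
  qed
qed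

text \<open>Since \<open>sinh y - y\<close> is o(\<open>y^2\<close>) and \<open>y\<close> is
  O(\<open>d^2\<close>), dividing by \<open>d^2\<close> returns the expansion of \<open>f\<close>
  unchanged. This is what compensates the factor \<open>p^2\<close>.\<close>

lemma jet2_sinh:
  assumes "jet2 f c0 c1 c2"
  shows "jet2 (\<lambda>d. sinh (d\<^sup>2 * f d) / d\<^sup>2) c0 c1 c2"
proof -
  obtain r where r: "(r \<longlongrightarrow> 0) (at_right 0)"
    "\<And>d. d > 0 \<Longrightarrow> f d = c0 + c1 * d + c2 * d\<^sup>2 + d\<^sup>2 * r d"
    using assms by (rule jet2E) blast
  define \<rho> where "\<rho> y = (sinh y - y) / y\<^sup>2" for y :: real
  have \<rho>: "\<rho> \<midarrow>0\<rightarrow> 0" "\<rho> 0 = 0"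
    unfolding \<rho>_def by (real_asymp, simp)
  have sinh_eq: "sinh y = y + y\<^sup>2 * \<rho> y" for y
    by (cases "y = 0") (simp_all add: \<rho>_def)
  have f0: "((\<lambda>d. d\<^sup>2 * f d) \<longlongrightarrow> 0) (at_right 0)"
    using tendsto_mult[OF tendsto_power[OF tendsto_ident_at, of 2] jet2_tendsto[OF assms]] by simp
  have "((\<lambda>d. r d + (f d)\<^sup>2 * \<rho> (d\<^sup>2 * f d)) \<longlongrightarrow> 0 + c0\<^sup>2 * 0) (at_right 0)"
    by (intro tendsto_intros r(1) jet2_tendsto[OF assms] tendsto_remainder_compose[OF \<rho> f0])
  then have "((\<lambda>d. r d + (f d)\<^sup>2 * \<rho> (d\<^sup>2 * f d)) \<longlongrightarrow> 0) (at_right 0)" by simp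
  then show ?thesis
  proof (rule jet2I)
    fix d :: real assume d: "d > 0"
    have "sinh (d\<^sup>2 * f d) / d\<^sup>2 = f d + d\<^sup>2 * ((f d)\<^sup>2 * \<rho> (d\<^sup>2 * f d))"
      unfolding sinh_eq[of "d\<^sup>2 * f d"] using d by (simp add: field_simps power2_eq_square)
    then show "sinh (d\<^sup>2 * f d) / d\<^sup>2
      = c0 + c1 * d + c2 * d\<^sup>2 + d\<^sup>2 * (r d + (f d)\<^sup>2 * \<rho> (d\<^sup>2 * f d))"
      by (simp add: r(2)[OF d] distrib_left)
  qed
qed

lemma jet2_cosh:
  assumes "jet2 f c0 c1 c2"
  shows "jet2 (\<lambda>d. cosh (d\<^sup>2 * f d)) 1 0 0"
proof -
  define \<rho> where "\<rho> y = (cosh y - 1) / y" for y :: real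
  have \<rho>: "\<rho> \<midarrow>0\<rightarrow> 0" "\<rho> 0 = 0"
    unfolding \<rho>_def by (real_asymp, simp)
  have cosh_eq: "cosh y = 1 + y * \<rho> y" for y
    by (cases "y = 0") (simp_all add: \<rho>_def)
  have f0: "((\<lambda>d. d\<^sup>2 * f d) \<longlongrightarrow> 0) (at_right 0)"
    using tendsto_mult[OF tendsto_power[OF tendsto_ident_at, of 2] jet2_tendsto[OF assms]] by simp
  have "((\<lambda>d. f d * \<rho> (d\<^sup>2 * f d)) \<longlongrightarrow> c0 * 0) (at_right 0)"
    by (intro tendsto_intros jet2_tendsto[OF assms] tendsto_remainder_compose[OF \<rho> f0])
  then have "((\<lambda>d. f d * \<rho> (d\<^sup>2 * f d)) \<longlongrightarrow> 0) (at_right 0)" by simp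
  then show ?thesis
    by (rule jet2I) (simp add: cosh_eq)
qed

section \<open>Odd and even differences in the lattice direction\<close>

definition shifted :: "real \<Rightarrow> (real \<times> real \<Rightarrow> real) \<Rightarrow> real \<Rightarrow> real \<Rightarrow> real \<Rightarrow> real \<Rightarrow> real" where
  "shifted \<beta> f x t \<nu> d = f (x + \<nu> * d * (1 - \<beta> * d), t + 1/2 * \<nu> * d\<^sup>2)"

definition odd_diff :: "real \<Rightarrow> (real \<times> real \<Rightarrow> real) \<Rightarrow> real \<Rightarrow> real \<Rightarrow> real \<Rightarrow> real" where
  "odd_diff \<beta> f x t d = (shifted \<beta> f x t 1 d - shifted \<beta> f x t (-1) d) / (2 * d)"

definition even_diff :: "real \<Rightarrow> (real \<times> real \<Rightarrow> real) \<Rightarrow> real \<Rightarrow> real \<Rightarrow> real \<Rightarrow> real" where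
  "even_diff \<beta> f x t d =
     (shifted \<beta> f x t 1 d + shifted \<beta> f x t (-1) d - 2 * f (x, t)) / (2 * d\<^sup>2)"

lemma shifted_expansion:
  assumes "smooth f"
  shows "\<exists>e. (e \<longlongrightarrow> 0) (at_right 0) \<and> (\<forall>d. shifted \<beta> f x t \<nu> d =
     taylor4 f x t (\<nu> * d * (1 - \<beta> * d)) (1/2 * \<nu> * d\<^sup>2) + d ^ 4 * e d)"
proof -
  have h: "((\<lambda>d. \<nu> * (1 - \<beta> * d)) \<longlongrightarrow> \<nu> * (1 - \<beta> * 0)) (at_right 0)"
    by (intro tendsto_intros)
  show ?thesis
    using weighted_taylor[OF assms h tendsto_const[of "\<nu> / 2"], of x t]
    by (simp add: shifted_def mult_ac)
qed

text \<open>Both displacements change sign with \<nu>, so only \<open>h\<close>, \<open>k\<close>,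
  \<open>h^3\<close> and \<open>h^2 k\<close> survive in the difference. The last has weight 4 and,
  after division by \<open>d\<close>, belongs to the remainder.\<close>

lemma jet2_odd_diff:
  assumes "smooth f"
  shows "jet2 (odd_diff \<beta> f x t) (Dx f (x, t)) (Dt f (x, t) / 2 - \<beta> * Dx f (x, t))
           ((Dx ^^ 3) f (x, t) / 6)"
proof -
  obtain p where p: "(p \<longlongrightarrow> 0) (at_right 0)" "\<And>d. shifted \<beta> f x t 1 d =
     taylor4 f x t (1 * d * (1 - \<beta> * d)) (1/2 * 1 * d\<^sup>2) + d ^ 4 * p d"
    using shifted_expansion[OF assms, of \<beta> x t 1] by blast
  obtain m where m: "(m \<longlongrightarrow> 0) (at_right 0)" "\<And>d. shifted \<beta> f x t (-1) d =
     taylor4 f x t (-1 * d * (1 - \<beta> * d)) (1/2 * (-1) * d\<^sup>2) + d ^ 4 * m d"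
    using shifted_expansion[OF assms, of \<beta> x t "-1"] by blast
  define e where "e d = ((1 - \<beta> * d) ^ 3 - 1) * (Dx ^^ 3) f (x, t) / 6
     + d * (1 - \<beta> * d)\<^sup>2 / 4 * Dt ((Dx ^^ 2) f) (x, t) + d * (p d - m d) / 2" for d
  have "(e \<longlongrightarrow> ((1 - \<beta> * 0) ^ 3 - 1) * (Dx ^^ 3) f (x, t) / 6
     + 0 * (1 - \<beta> * 0)\<^sup>2 / 4 * Dt ((Dx ^^ 2) f) (x, t) + 0 * (0 - 0) / 2) (at_right 0)"
    unfolding e_def by (intro tendsto_intros p(1) m(1)) auto
  then have "(e \<longlongrightarrow> 0) (at_right 0)" by simp
  then show ?thesis
  proof (rule jet2I)
    fix d :: real assume d: "d > 0"
    have "shifted \<beta> f x t 1 d - shifted \<beta> f x t (-1) d = 2 * d *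
      (Dx f (x, t) + (Dt f (x, t) / 2 - \<beta> * Dx f (x, t)) * d + (Dx ^^ 3) f (x, t) / 6 * d\<^sup>2
        + d\<^sup>2 * e d)"
      unfolding p(2) m(2) taylor4_def e_def
      by (simp add: field_simps power2_eq_square power3_eq_cube power4_eq_xxxx)
    then show "odd_diff \<beta> f x t d = Dx f (x, t) + (Dt f (x, t) / 2 - \<beta> * Dx f (x, t)) * d
        + (Dx ^^ 3) f (x, t) / 6 * d\<^sup>2 + d\<^sup>2 * e d"
      using d by (simp add: odd_diff_def)
  qed
qed

text \<open>The survivors are \<open>h^2\<close>, \<open>h k\<close>, \<open>h^4\<close> and
  \<open>k^2\<close>. Division by \<open>d^2\<close> is the reason why weight 4 had to be
  reached.\<close>

lemma jet2_even_diff: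
  assumes "smooth f"
  shows "jet2 (even_diff \<beta> f x t) ((Dx ^^ 2) f (x, t) / 2)
           (Dt (Dx f) (x, t) / 2 - \<beta> * (Dx ^^ 2) f (x, t))
           (\<beta>\<^sup>2 * (Dx ^^ 2) f (x, t) / 2 - \<beta> * Dt (Dx f) (x, t) / 2
             + (Dx ^^ 4) f (x, t) / 24 + (Dt ^^ 2) f (x, t) / 8)"
    (is "jet2 _ ?c0 ?c1 ?c2")
proof -
  obtain p where p: "(p \<longlongrightarrow> 0) (at_right 0)" "\<And>d. shifted \<beta> f x t 1 d =
     taylor4 f x t (1 * d * (1 - \<beta> * d)) (1/2 * 1 * d\<^sup>2) + d ^ 4 * p d"
    using shifted_expansion[OF assms, of \<beta> x t 1] by blast
  obtain m where m: "(m \<longlongrightarrow> 0) (at_right 0)" "\<And>d. shifted \<beta> f x t (-1) d =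
     taylor4 f x t (-1 * d * (1 - \<beta> * d)) (1/2 * (-1) * d\<^sup>2) + d ^ 4 * m d"
    using shifted_expansion[OF assms, of \<beta> x t "-1"] by blast
  define e where "e d = ((1 - \<beta> * d) ^ 4 - 1) * (Dx ^^ 4) f (x, t) / 24 + (p d + m d) / 2" for d
  have "(e \<longlongrightarrow> ((1 - \<beta> * 0) ^ 4 - 1) * (Dx ^^ 4) f (x, t) / 24 + (0 + 0) / 2) (at_right 0)"
    unfolding e_def by (intro tendsto_intros p(1) m(1)) auto
  then have "(e \<longlongrightarrow> 0) (at_right 0)" by simp
  then show ?thesis
  proof (rule jet2I)
    fix d :: real assume d: "d > 0"
    have "shifted \<beta> f x t 1 d + shifted \<beta> f x t (-1) d - 2 * f (x, t) = 2 * d\<^sup>2 *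
      (?c0 + ?c1 * d + ?c2 * d\<^sup>2 + d\<^sup>2 * e d)"
      unfolding p(2) m(2) taylor4_def e_def
      by (simp add: field_simps power2_eq_square power3_eq_cube power4_eq_xxxx)
    then show "even_diff \<beta> f x t d = ?c0 + ?c1 * d + ?c2 * d\<^sup>2 + d\<^sup>2 * e d"
      using d by (simp add: even_diff_def)
  qed
qed

section \<open>The lattice expression in exponential variables\<close>

lemma v_shift_eq_shifted:
  "v_shift \<alpha>\<^sub>2 V d t \<nu> x = exp (shifted (\<alpha>\<^sub>2 / 3) V x t (of_int \<nu>) d)"
  by (simp add: v_shift_def shifted_def)

lemma DERIV_shifted:
  assumes "smooth f"
  shows "((\<lambda>x. shifted \<beta> f x t \<nu> d) has_real_derivative shifted \<beta> (Dx f) x t \<nu> d) (at x)"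
  unfolding shifted_def by (rule DERIV_Dx_shift[OF assms])

lemma deriv_v_shift:
  assumes "smooth V"
  shows "deriv (v_shift \<alpha>\<^sub>2 V d t \<nu>) =
    (\<lambda>x. v_shift \<alpha>\<^sub>2 V d t \<nu> x * shifted (\<alpha>\<^sub>2 / 3) (Dx V) x t (of_int \<nu>) d)"
  unfolding v_shift_eq_shifted[abs_def]
  by (intro ext DERIV_imp_deriv DERIV_fun_exp DERIV_shifted assms)

lemma deriv2_v_shift:
  assumes "smooth V"
  shows "deriv (deriv (v_shift \<alpha>\<^sub>2 V d t \<nu>)) =
    (\<lambda>x. v_shift \<alpha>\<^sub>2 V d t \<nu> x * (shifted (\<alpha>\<^sub>2 / 3) ((Dx ^^ 2) V) x t (of_int \<nu>) d
        + (shifted (\<alpha>\<^sub>2 / 3) (Dx V) x t (of_int \<nu>) d)\<^sup>2))"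
  unfolding deriv_v_shift[OF assms] unfolding v_shift_eq_shifted[abs_def]
  by (intro ext DERIV_imp_deriv)
    (auto intro!: derivative_eq_intros DERIV_shifted assms smooth_Dx
      simp: power2_eq_square numeral_2_eq_2 algebra_simps)

lemma shifted_0: "shifted \<beta> f x t 0 d = f (x, t)"
  by (simp add: shifted_def)

lemma shifted_1:
  "d \<noteq> 0 \<Longrightarrow> shifted \<beta> f x t 1 d = f (x, t) + d * odd_diff \<beta> f x t d + d\<^sup>2 * even_diff \<beta> f x t d"
  by (simp add: odd_diff_def even_diff_def field_simps)

lemma shifted_minus_1:
  "d \<noteq> 0 \<Longrightarrow> shifted \<beta> f x t (-1) d = f (x, t) - d * odd_diff \<beta> f x t d + d\<^sup>2 * even_diff \<beta> f x t d"
  by (simp add: odd_diff_def even_diff_def field_simps)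

text \<open>A divided difference of a polynomial, in which \<open>\<alpha>\<^sub>0\<close> cancels;
  this explains its absence from the limit.\<close>

lemma g3_difference_quotient:
  assumes "p \<noteq> a"
  shows "(g3 \<alpha>\<^sub>0 \<alpha>\<^sub>1 \<alpha>\<^sub>2 p - g3 \<alpha>\<^sub>0 \<alpha>\<^sub>1 \<alpha>\<^sub>2 a) / (a - p) =
    - (p\<^sup>2 + p * a + a\<^sup>2 + \<alpha>\<^sub>2 * (p + a) + \<alpha>\<^sub>1)"
proof -
  have "g3 \<alpha>\<^sub>0 \<alpha>\<^sub>1 \<alpha>\<^sub>2 p - g3 \<alpha>\<^sub>0 \<alpha>\<^sub>1 \<alpha>\<^sub>2 a
      = - (p\<^sup>2 + p * a + a\<^sup>2 + \<alpha>\<^sub>2 * (p + a) + \<alpha>\<^sub>1) * (a - p)"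
    by (simp add: g3_def algebra_simps power2_eq_square power3_eq_cube)
  then show ?thesis using assms by simp
qed

text \<open>Pure algebra: \<open>X\<close>, \<open>Y\<close> are the first two logarithmic
  derivatives of \<open>v 0\<close>, and \<open>u1\<close>, \<open>w1\<close>, \<open>u2\<close>,
  \<open>w2\<close> are free numbers standing for derivatives of \<open>u\<close> and
  \<open>w\<close>. Typically \<open>v 1 / v 0 - v 0 / v (-1)\<close> equals
  \<open>exp u * (exp w - exp (- w))\<close>; \<open>u2\<close> cancels between the two
  neighbours.\<close>

lemma S_exponential_form:
  fixes V0 u w :: real
  assumes "p \<noteq> a"
    and v: "v 0 x = exp V0" "v 1 x = exp (V0 + u + w)" "v (-1) x = exp (V0 - u + w)"
    and v': "deriv (v 0) x = v 0 x * X" "deriv (v 1) x = v 1 x * (X + u1 + w1)"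
      "deriv (v (-1)) x = v (-1) x * (X - u1 + w1)"
    and v'': "deriv (deriv (v 0)) x = v 0 x * (Y + X\<^sup>2)"
      "deriv (deriv (v 1)) x = v 1 x * (Y + u2 + w2 + (X + u1 + w1)\<^sup>2)"
      "deriv (deriv (v (-1))) x = v (-1) x * (Y - u2 + w2 + (X - u1 + w1)\<^sup>2)"
  shows "S \<alpha>\<^sub>0 \<alpha>\<^sub>1 \<alpha>\<^sub>2 a p v x =
    3 * Y + 2 * w2 - 6 * u1 * X - 4 * u1 * w1
    + 6 * (p - a) * exp (- u) * ((X + w1) * sinh w - u1 * cosh w)
    - 2 * (\<alpha>\<^sub>2 + 3 * a) * u1
    + 2 * exp u * sinh w * (p\<^sup>2 + p * a + a\<^sup>2 + \<alpha>\<^sub>2 * (p + a) + \<alpha>\<^sub>1)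
    + 2 * exp (- u) * sinh w * (\<alpha>\<^sub>2 + 3 * a) * (p - a)
    + 2 * exp (- 2 * u) * sinh (2 * w) * (p - a)\<^sup>2"
proof -
  have nz: "v 0 x \<noteq> 0" "v 1 x \<noteq> 0" "v (-1) x \<noteq> 0"
    unfolding v by simp_all
  have "v 1 x / v 0 x = exp u * exp w" "v 0 x / v (-1) x = exp u * exp (- w)"
    "v (-1) x / v 0 x = exp (- u) * exp w" "v 0 x / v 1 x = exp (- u) * exp (- w)"
    unfolding v by (simp_all add: exp_add[symmetric] exp_diff[symmetric])
  note q = this
  have q2: "(v (-1) x)\<^sup>2 / (v 0 x)\<^sup>2 = exp (- 2 * u) * exp (2 * w)"
    "(v 0 x)\<^sup>2 / (v 1 x)\<^sup>2 = exp (- 2 * u) * exp (- 2 * w)"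
    using q by (simp_all add: power_divide[symmetric] power_mult_distrib exp_double[symmetric])
  have quot: "v 1 x * z / v 1 x = z" "v 0 x * z / v 0 x = z" "v (-1) x * z / v (-1) x = z" for z
    using nz by simp_all
  have cross: "v 1 x * y * (v 0 x * z) / (v 1 x * v 0 x) = y * z"
    "v (-1) x * y * (v 0 x * z) / (v (-1) x * v 0 x) = y * z" for y z
    using nz by simp_all
  have mixed: "v (-1) x * z / v 0 x = exp (- u) * exp w * z"
    "v 1 x * z * v 0 x / (v 1 x)\<^sup>2 = exp (- u) * exp (- w) * z" for z
    unfolding q[symmetric] using nz by (simp_all add: power2_eq_square)
  have hyp: "exp w = cosh w + sinh w" "exp (- w) = cosh w - sinh w"
    "exp (2 * w) = cosh (2 * w) + sinh (2 * w)" "exp (- 2 * w) = cosh (2 * w) - sinh (2 * w)"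
    by (simp_all add: cosh_plus_sinh cosh_minus_sinh)
  show ?thesis
    unfolding S_def Let_def g3_difference_quotient[OF assms(1)]
    unfolding v' v'' cross quot mixed q q2 hyp
    by (simp add: algebra_simps power2_eq_square)
qed

text \<open>With \<open>u = d * U V\<close> and \<open>w = d^2 * W V\<close>, every power of
  \<open>p = 1 / d\<close> is paired with a small factor: \<open>p^2\<close> with
  \<open>sinh\<close>, and \<open>p\<close> with \<open>u1\<close> or again with
  \<open>sinh\<close>. The bracketing, as in \<open>d * (d * ...)\<close> and
  \<open>exp (d * - U V)\<close>, follows the shapes that the \<open>jet2\<close> rules
  produce.\<close>

lemma S_v_shift:
  fixes \<alpha>\<^sub>2 a d x t :: real
  assumes "smooth V" "d > 0" "1 / d \<noteq> a"
  defines "U \<equiv> \<lambda>f. odd_diff (\<alpha>\<^sub>2 / 3) f x t d" and "W \<equiv> \<lambda>f. even_diff (\<alpha>\<^sub>2 / 3) f x t d"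
    and "b \<equiv> \<alpha>\<^sub>2 + 3 * a"
  shows "S \<alpha>\<^sub>0 \<alpha>\<^sub>1 \<alpha>\<^sub>2 a (1 / d) (v_shift \<alpha>\<^sub>2 V d t) x =
    3 * (Dx ^^ 2) V (x, t) + 2 * (d * (d * W ((Dx ^^ 2) V))) - 6 * Dx V (x, t) * (d * U (Dx V))
    - 4 * (d * (U (Dx V) * (d * (d * W (Dx V)))))
    + 6 * ((1 - a * d) * (exp (d * - U V) *
        ((Dx V (x, t) + d * (d * W (Dx V))) * (d * (sinh (d\<^sup>2 * W V) / d\<^sup>2))
          - U (Dx V) * cosh (d\<^sup>2 * W V))))
    - 2 * b * (d * U (Dx V))
    + 2 * (exp (d * U V) * ((sinh (d\<^sup>2 * W V) / d\<^sup>2) *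
        (1 + d * ((a + \<alpha>\<^sub>2) + d * (a\<^sup>2 + \<alpha>\<^sub>2 * a + \<alpha>\<^sub>1)))))
    + 2 * b * (exp (d * - U V) * ((sinh (d\<^sup>2 * W V) / d\<^sup>2) * (d * (1 - a * d))))
    + 2 * (exp (d * (- 2 * U V)) * ((sinh (d\<^sup>2 * (2 * W V)) / d\<^sup>2) * ((1 - a * d) * (1 - a * d))))"
  (is "_ = ?R")
proof -
  have d: "d \<noteq> 0" using assms(2) by simp
  have D: "deriv (v_shift \<alpha>\<^sub>2 V d t \<nu>) x =
      v_shift \<alpha>\<^sub>2 V d t \<nu> x * shifted (\<alpha>\<^sub>2 / 3) (Dx V) x t (of_int \<nu>) d" for \<nu>
    by (simp add: deriv_v_shift[OF assms(1)])
  have D2: "deriv (deriv (v_shift \<alpha>\<^sub>2 V d t \<nu>)) x =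
      v_shift \<alpha>\<^sub>2 V d t \<nu> x * (shifted (\<alpha>\<^sub>2 / 3) ((Dx ^^ 2) V) x t (of_int \<nu>) d
        + (shifted (\<alpha>\<^sub>2 / 3) (Dx V) x t (of_int \<nu>) d)\<^sup>2)" for \<nu>
    by (simp add: deriv2_v_shift[OF assms(1)])
  have "S \<alpha>\<^sub>0 \<alpha>\<^sub>1 \<alpha>\<^sub>2 a (1 / d) (v_shift \<alpha>\<^sub>2 V d t) x =
    3 * (Dx ^^ 2) V (x, t) + 2 * (d\<^sup>2 * W ((Dx ^^ 2) V)) - 6 * (d * U (Dx V)) * Dx V (x, t)
    - 4 * (d * U (Dx V)) * (d\<^sup>2 * W (Dx V))
    + 6 * (1 / d - a) * exp (- (d * U V)) * ((Dx V (x, t) + d\<^sup>2 * W (Dx V)) * sinh (d\<^sup>2 * W V)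
        - d * U (Dx V) * cosh (d\<^sup>2 * W V))
    - 2 * (\<alpha>\<^sub>2 + 3 * a) * (d * U (Dx V))
    + 2 * exp (d * U V) * sinh (d\<^sup>2 * W V)
        * ((1 / d)\<^sup>2 + 1 / d * a + a\<^sup>2 + \<alpha>\<^sub>2 * (1 / d + a) + \<alpha>\<^sub>1)
    + 2 * exp (- (d * U V)) * sinh (d\<^sup>2 * W V) * (\<alpha>\<^sub>2 + 3 * a) * (1 / d - a)
    + 2 * exp (- 2 * (d * U V)) * sinh (2 * (d\<^sup>2 * W V)) * (1 / d - a)\<^sup>2"
    unfolding U_def W_def
    by (rule S_exponential_form[OF assms(3)])
      (unfold D D2, simp_all add: v_shift_eq_shifted shifted_0 shifted_1[OF d] shifted_minus_1[OF d])
  also have "\<dots> = ?R"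
  proof -
    have e: "exp (- (d * U V)) = exp (d * - U V)" "exp (- 2 * (d * U V)) = exp (d * (- 2 * U V))"
      "sinh (2 * (d\<^sup>2 * W V)) = sinh (d\<^sup>2 * (2 * W V))"
      by (simp_all add: mult_ac)
    show ?thesis
      unfolding e b_def using d
      by (simp add: field_simps power2_eq_square)
  qed
  finally show ?thesis .
qed

section \<open>Assembly of the expansions and passage to the limit\<close>

theorem mainTheorem10:
  fixes \<alpha>\<^sub>0 \<alpha>\<^sub>1 \<alpha>\<^sub>2 a :: real and V :: "real \<times> real \<Rightarrow> real"
  assumes "smooth V"
  shows "\<forall>x t. ((\<lambda>\<delta>. 4 / \<delta> ^ 2 * S \<alpha>\<^sub>0 \<alpha>\<^sub>1 \<alpha>\<^sub>2 a (1 / \<delta>) (v_shift \<alpha>\<^sub>2 V \<delta> t) x) \<longlongrightarrow>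
      (Dx ^^ 4) V (x, t)
      - 6 * (Dx ^^ 2) V (x, t) * (Dx V (x, t)) ^ 2
      + 6 * (Dx ^^ 2) V (x, t) * Dt V (x, t)
      - 4 * (\<alpha>\<^sub>2 + 3 * a) * (Dx ^^ 2) V (x, t) * Dx V (x, t)
      + 4 * (\<alpha>\<^sub>1 - 1/3 * \<alpha>\<^sub>2 ^ 2) * (Dx ^^ 2) V (x, t)
      + 3 * (Dt ^^ 2) V (x, t)) (at_right 0)"
proof (intro allI)
  fix x t
  \<comment> \<open>The mixed derivative \<open>Dt (Dx V)\<close> enters at order 2 with total
    coefficient \<open>\<alpha>\<^sub>2 - 3 * \<beta>\<close>; this choice of \<beta> removes
    it.\<close>
  define \<beta> b where "\<beta> = \<alpha>\<^sub>2 / 3" and "b = \<alpha>\<^sub>2 + 3 * a"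
  define U W where "U f = odd_diff \<beta> f x t" and "W f = even_diff \<beta> f x t" for f
  note sm = assms smooth_Dx[OF assms] smooth_Dx_funpow[OF assms]
  have Dx_simps: "(Dx ^^ 2) (Dx V) = (Dx ^^ 3) V" "(Dx ^^ 3) (Dx V) = (Dx ^^ 4) V"
    "(Dx ^^ 2) ((Dx ^^ 2) V) = (Dx ^^ 4) V" "Dx (Dx V) = (Dx ^^ 2) V"
    by (simp_all add: eval_nat_numeral)
  have jU: "jet2 (U V) (Dx V (x, t)) (Dt V (x, t) / 2 - \<beta> * Dx V (x, t)) ((Dx ^^ 3) V (x, t) / 6)"
    unfolding U_def by (rule jet2_odd_diff) (rule sm)
  have jU1: "jet2 (U (Dx V)) ((Dx ^^ 2) V (x, t)) (Dt (Dx V) (x, t) / 2 - \<beta> * (Dx ^^ 2) V (x, t))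
      ((Dx ^^ 4) V (x, t) / 6)"
    unfolding U_def using jet2_odd_diff[OF sm(2)] by (simp only: Dx_simps)
  note jW = jet2_even_diff[OF sm(1), of \<beta> x t, folded W_def]
  note jW1 = jet2_even_diff[OF sm(2), of \<beta> x t, folded W_def, unfolded Dx_simps]
  note jW2 = jet2_even_diff[OF sm(3)[of 2], of \<beta> x t, folded W_def, unfolded Dx_simps]
  note js = jet2_sinh[OF jW]
  note jU' = jet2_cmult[OF jU, of "-1"] jet2_cmult[OF jU, of "-2"]
  note j1 = jet2_diff[OF jet2_const[of 1] jet2_cmult[OF jet2_ident, of a]]
  \<comment> \<open>The nesting of rules copies the term structure of \<open>?F\<close> below, so
    the three coefficients are computed by the rules themselves.\<close>
  note j = jet2_add[OF jet2_add[OF jet2_add[OF jet2_diff[OF jet2_add[OF jet2_diff[OF jet2_diff[OF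
    jet2_add[OF jet2_const[of "3 * (Dx ^^ 2) V (x, t)"]
      jet2_cmult[OF jet2_ident_mult[OF jet2_ident_mult[OF jW2]], of 2]]
      jet2_cmult[OF jet2_ident_mult[OF jU1], of "6 * Dx V (x, t)"]]
      jet2_cmult[OF jet2_ident_mult[OF jet2_mult[OF jU1 jet2_ident_mult[OF jet2_ident_mult[OF jW1]]]], of 4]]
      jet2_cmult[OF jet2_mult[OF j1 jet2_mult[OF jet2_exp[OF jU'(1)]
        jet2_diff[OF jet2_mult[OF jet2_add[OF jet2_const[of "Dx V (x, t)"]
            jet2_ident_mult[OF jet2_ident_mult[OF jW1]]] jet2_ident_mult[OF js]]
          jet2_mult[OF jU1 jet2_cosh[OF jW]]]]], of 6]]
      jet2_cmult[OF jet2_ident_mult[OF jU1], of "2 * b"]]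
      jet2_cmult[OF jet2_mult[OF jet2_exp[OF jU] jet2_mult[OF js
        jet2_add[OF jet2_const[of 1] jet2_ident_mult[OF jet2_add[OF jet2_const[of "a + \<alpha>\<^sub>2"]
          jet2_cmult[OF jet2_ident, of "a\<^sup>2 + \<alpha>\<^sub>2 * a + \<alpha>\<^sub>1"]]]]]], of 2]]
      jet2_cmult[OF jet2_mult[OF jet2_exp[OF jU'(1)] jet2_mult[OF js jet2_ident_mult[OF j1]]], of "2 * b"]]
      jet2_cmult[OF jet2_mult[OF jet2_exp[OF jU'(2)] jet2_mult[OF
        jet2_sinh[OF jet2_cmult[OF jW, of 2]] jet2_mult[OF j1 j1]]], of 2]]
  show "((\<lambda>\<delta>. 4 / \<delta> ^ 2 * S \<alpha>\<^sub>0 \<alpha>\<^sub>1 \<alpha>\<^sub>2 a (1 / \<delta>) (v_shift \<alpha>\<^sub>2 V \<delta> t) x) \<longlongrightarrow>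
      (Dx ^^ 4) V (x, t)
      - 6 * (Dx ^^ 2) V (x, t) * (Dx V (x, t)) ^ 2
      + 6 * (Dx ^^ 2) V (x, t) * Dt V (x, t)
      - 4 * (\<alpha>\<^sub>2 + 3 * a) * (Dx ^^ 2) V (x, t) * Dx V (x, t)
      + 4 * (\<alpha>\<^sub>1 - 1/3 * \<alpha>\<^sub>2 ^ 2) * (Dx ^^ 2) V (x, t)
      + 3 * (Dt ^^ 2) V (x, t)) (at_right 0)" (is "(_ \<longlongrightarrow> ?L) _")
  proof -
    let ?F = "\<lambda>d. 3 * (Dx ^^ 2) V (x, t) + 2 * (d * (d * W ((Dx ^^ 2) V) d))
    - 6 * Dx V (x, t) * (d * U (Dx V) d)
    - 4 * (d * (U (Dx V) d * (d * (d * W (Dx V) d))))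
    + 6 * ((1 - a * d) * (exp (d * - U V d) *
        ((Dx V (x, t) + d * (d * W (Dx V) d)) * (d * (sinh (d\<^sup>2 * W V d) / d\<^sup>2))
          - U (Dx V) d * cosh (d\<^sup>2 * W V d))))
    - 2 * b * (d * U (Dx V) d)
    + 2 * (exp (d * U V d) * ((sinh (d\<^sup>2 * W V d) / d\<^sup>2) *
        (1 + d * ((a + \<alpha>\<^sub>2) + d * (a\<^sup>2 + \<alpha>\<^sub>2 * a + \<alpha>\<^sub>1)))))
    + 2 * b * (exp (d * - U V d) * ((sinh (d\<^sup>2 * W V d) / d\<^sup>2) * (d * (1 - a * d))))
    + 2 * (exp (d * (- 2 * U V d)) * ((sinh (d\<^sup>2 * (2 * W V d)) / d\<^sup>2) * ((1 - a * d) * (1 - a * d))))"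
    \<comment> \<open>At order 0 the multiples of \<open>(Dx ^^ 2) V\<close> sum to 3 + 1 - 6 + 2 =
      0. At order 1 all cancels but \<open>(3 * a + \<alpha>\<^sub>2 - b) * (Dx ^^ 2) V\<close>,
      which is 0 by the definition of \<open>b\<close>.\<close>
    have F: "jet2 ?F 0 0 (?L / 4)"
      by (rule jet2_cong[OF j])
        (simp add: mult_ac, simp add: field_simps,
          simp_all add: field_simps power2_eq_square b_def \<beta>_def)
    have quarter: "4 * (c / 4) = c" for c :: real by simp
    have lim: "((\<lambda>d. 4 * (?F d / d\<^sup>2)) \<longlongrightarrow> ?L) (at_right 0)"
      using tendsto_mult_left[OF jet2_quotient_tendsto[OF F], of 4] by (simp only: quarter)
    \<comment> \<open>For small \<open>d\<close> the value \<open>p = 1 / d\<close> exceeds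
      \<open>a\<close>, which secures \<open>p \<noteq> a\<close>.\<close>
    have "filterlim (\<lambda>d. 1 / d) at_top (at_right (0::real))"
      by real_asymp
    then have "eventually (\<lambda>d. 1 / d > a) (at_right 0)"
      by (simp add: filterlim_at_top_dense)
    moreover have "eventually (\<lambda>d. d > (0::real)) (at_right 0)"
      by (rule eventually_at_right_less)
    ultimately have "eventually (\<lambda>d. 4 * (?F d / d\<^sup>2) =
        4 / d ^ 2 * S \<alpha>\<^sub>0 \<alpha>\<^sub>1 \<alpha>\<^sub>2 a (1 / d) (v_shift \<alpha>\<^sub>2 V d t) x) (at_right 0)"
    proof eventually_elim
      case (elim d)
      have "S \<alpha>\<^sub>0 \<alpha>\<^sub>1 \<alpha>\<^sub>2 a (1 / d) (v_shift \<alpha>\<^sub>2 V d t) x = ?F d"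
        unfolding U_def W_def b_def \<beta>_def
        by (rule S_v_shift[OF assms elim(2)]) (use elim(1) in simp)
      then show ?case by simp
    qed
    with lim show ?thesis by (rule Lim_transform_eventually)
  qed
qed

end
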